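(* Let $D=d=2$, let $\mathbf{s}=(0,1,1,1,1,\ldots)\in\{0,1\}^\infty$ (first entry $0$, all later entries $1$), and let $\{\mathbf{s}^N\}_{N=1}^\infty$ be any sequence of templates in $\{0,1\}^\infty$ such that $\lim_{N\to\infty}\|\mathbf{s}^N-\mathbf{s}\|=0$ and such that $\mathbf{s}^N\ne\mathbf{s}$ for infinitely many $N$. Then $$\mathrm{dist}\left(\mathcal{M}^{\mathbf{s}},\mathcal{M}^{\mathbf{s}^N}\right)\not\to 0\quad\text{as } N\to\infty,$$ where $\mathrm{dist}(A,B)=\sup_{a\in A}\inf_{b\in B}\mathrm{dist}(a,b)$ is the one-sided distance from $A$ to $B$.
   Context: Templates: a template is a sequence $\mathbf{s}=\{s_m\}_{m=1}^\infty\in\{0,\ldots,D-1\}^\infty$. The space of templates carries the metric $\|\mathbf{s}-\tilde{\mathbf{s}}\|=\sum_{k=1}^\infty |s_k-\tilde s_k|/D^k$ (here $D=2$). Template iteration: for $\mathbf{c}=(c_0,\ldots,c_{D-1})\in\mathbb{C}^D$ and $\mathbf{d}=(d_0,\ldots,d_{D-1})\in\{2,\ldots,d\}^D$, put $f_{(c_i,d_i)}(z)=z^{d_i}+c_i$. For a template $\mathbf{s}$ let $P_m^{\mathbf{s},\mathbf{c},\mathbf{d}}=f_{(c_{s_m},d_{s_m})}$ for $m\ge 1$, and for $0\le m<n$ let $Q_{m,n}^{\mathbf{s},\mathbf{c},\mathbf{d}}=P_n^{\mathbf{s},\mathbf{c},\mathbf{d}}\circ\cdots\circ P_{m+1}^{\mathbf{s},\mathbf{c},\mathbf{d}}$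 (with $Q_{m,m}$ the identity). Fixed-template Mandelbrot set (with degree bound $d$): $\mathcal{M}^{\mathbf{s}}$ is the set of all $(\mathbf{c},\mathbf{d})\in\mathbb{C}^D\times\{2,\ldots,d\}^D$ such that for every $m\ge 0$ the sequence $\{Q_{m,n}^{\mathbf{s},\mathbf{c},\mathbf{d}}(0)\}_{n\ge m}$ is bounded. When $D=d=2$ all polynomials are $z^2+c_0$ or $z^2+c_1$, and $\mathcal{M}^{\mathbf{s}}\subset\mathbb{C}^2\times\{2\}^2$ may be identified with a subset of $\mathbb{C}^2$. Metric on parameter space: on $\mathbb{C}^D\times\{2,\ldots,d\}^D$, $\mathrm{dist}((\mathbf{c},\mathbf{d}),(\tilde{\mathbf{c}},\tilde{\mathbf{d}}))=\max_{0\le i\le D-1}\max\{|\tilde c_i-c_i|,|\tilde d_i-d_i|\}$; for $D=d=2$ this is $\max\{|\tilde c_0-c_0|,|\tilde c_1-c_1|\}$. *)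

theory Defs
  imports "HOL-Analysis.Analysis"
begin

text \<open>
  Templates are indexed from 1, and parameters by \<open>0, \<dots>, D - 1\<close>. Both are extensional
  functions (\<^const>\<open>undefined\<close> outside their index set), so that equality of HOL functions is
  equality of sequences and of tuples.
\<close>

type_synonym template = "nat \<Rightarrow> nat"
type_synonym param = "(nat \<Rightarrow> complex) \<times> (nat \<Rightarrow> nat)"

definition templates :: "nat \<Rightarrow> template set" where
  "templates D = {1..} \<rightarrow>\<^sub>E {0..<D}"

definition template_dist :: "nat \<Rightarrow> template \<Rightarrow> template \<Rightarrow> real" where
  "template_dist D s t = (\<Sum>k. \<bar>real (s (Suc k)) - real (t (Suc k))\<bar> / real D ^ Suc k)"

definition param_space :: "nat \<Rightarrow> nat \<Rightarrow> param set" where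
  "param_space D d = ({0..<D} \<rightarrow>\<^sub>E UNIV) \<times> ({0..<D} \<rightarrow>\<^sub>E {2..d})"

definition param_dist :: "nat \<Rightarrow> param \<Rightarrow> param \<Rightarrow> real" where
  "param_dist D p q = Max ((\<lambda>i. max (cmod (fst q i - fst p i))
                                   \<bar>real (snd q i) - real (snd p i)\<bar>) ` {0..<D})"

definition template_poly :: "template \<Rightarrow> param \<Rightarrow> nat \<Rightarrow> complex \<Rightarrow> complex" where
  "template_poly s p m z = z ^ snd p (s m) + fst p (s m)"

text \<open>\<open>P\<^sub>n \<circ> \<dots> \<circ> P\<^bsub>m+1\<^esub>\<close>: \<^const>\<open>fold\<close> applies the function with the leftmost index first.\<close>

definition template_iter :: "template \<Rightarrow> param \<Rightarrow> nat \<Rightarrow> nat \<Rightarrow> complex \<Rightarrow> complex" where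
  "template_iter s p m n = fold (template_poly s p) [m + 1..<n + 1]"

definition mandelbrot_fixed :: "nat \<Rightarrow> nat \<Rightarrow> template \<Rightarrow> param set" where
  "mandelbrot_fixed D d s =
     {p \<in> param_space D d. \<forall>m. bounded ((\<lambda>n. template_iter s p m n 0) ` {m..})}"

text \<open>
  The one-sided distance takes values in \<open>[0, \<infinity>]\<close>, so that the supremum and the infimum are the
  true ones even for unbounded or empty sets.
\<close>

definition one_sided_dist :: "('a \<Rightarrow> 'a \<Rightarrow> real) \<Rightarrow> 'a set \<Rightarrow> 'a set \<Rightarrow> ennreal" where
  "one_sided_dist \<delta> A B = (SUP a\<in>A. INF b\<in>B. ennreal (\<delta> a b))"

definition template_01 :: template where
  "template_01 = (\<lambda>m\<in>{1..}. if m = 1 then 0 else 1)"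

end

theory Submission
  imports Defs
begin

text \<open>
  The parameter \<open>(c\<^sub>0, c\<^sub>1) = (2, -2)\<close> lies in the Mandelbrot set of the template \<open>(0,1,1,1,\<dots>)\<close>:
  the point \<open>2\<close> is fixed by \<open>z\<^sup>2 - 2\<close>, and every critical orbit reaches it within two steps
  (\<open>two_minus_two_in_mandelbrot\<close>). On the other hand, suppose that a template contains a \<open>1\<close>
  immediately followed by a \<open>0\<close>. The critical orbit started just before that \<open>1\<close> runs
  \<open>0, c\<^sub>1, c\<^sub>1\<^sup>2 + c\<^sub>0\<close>, and the last value is close to \<open>6\<close> when \<open>(c\<^sub>0, c\<^sub>1)\<close> is close to \<open>(2, -2)\<close>,
  well outside the escape radius. So the Mandelbrot set of such a template keeps a distance of
  at least \<open>1/2\<close> from \<open>(2, -2)\<close> (\<open>mandelbrot_far_from_two_minus_two\<close>).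

  A template different from \<open>(0,1,1,1,\<dots>)\<close> but close to it starts with \<open>0, 1\<close> and has a \<open>0\<close> later
  on, hence has such a descent from \<open>1\<close> to \<open>0\<close>. Therefore the one-sided distance is at least \<open>1/2\<close>
  for infinitely many \<open>N\<close>.
\<close>

lemma template_iter_self [simp]: "template_iter s p m m z = z"
  by (simp add: template_iter_def)

lemma template_iter_Suc:
  assumes "m \<le> n"
  shows "template_iter s p m (Suc n) z = template_poly s p (Suc n) (template_iter s p m n z)"
  using assms by (simp add: template_iter_def)

lemma templates_ltD: "s \<in> templates D \<Longrightarrow> n \<ge> 1 \<Longrightarrow> s n < D"
  by (auto simp: templates_def dest!: PiE_mem[where x = n])

lemma template_01_in_templates: "template_01 \<in> templates 2"
  by (auto simp: template_01_def templates_def)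

lemma template_dist_ge:
  assumes D: "D \<ge> 2" and s: "s \<in> templates D" and t: "t \<in> templates D"
    and n: "n \<ge> 1" and ne: "s n \<noteq> t n"
  shows "template_dist D s t \<ge> 1 / real D ^ n"
proof -
  define f where "f = (\<lambda>k. \<bar>real (s (Suc k)) - real (t (Suc k))\<bar> / real D ^ Suc k)"
  have "summable (\<lambda>k. (1 / real D) ^ k)"
    using D by (intro summable_geometric) auto
  moreover have "norm (f k) \<le> (1 / real D) ^ k" for k
  proof -
    have "\<bar>real (s (Suc k)) - real (t (Suc k))\<bar> \<le> real D"
      using templates_ltD[OF s, of "Suc k"] templates_ltD[OF t, of "Suc k"] by auto
    then show ?thesis
      using D by (simp add: f_def field_simps)
  qed
  ultimately have "summable f"
    by (rule summable_comparison_test')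
  then have "f (n - 1) \<le> suminf f"
    using sum_le_suminf[of f "{n - 1}"] by (simp add: f_def)
  moreover have "1 / real D ^ n \<le> f (n - 1)"
  proof -
    have "1 \<le> \<bar>real (s n) - real (t n)\<bar>"
      using ne by linarith
    moreover have "f (n - 1) = \<bar>real (s n) - real (t n)\<bar> / real D ^ n"
      using n by (simp add: f_def del: power_Suc)
    ultimately show ?thesis
      using D by (simp add: divide_right_mono)
  qed
  ultimately show ?thesis
    by (simp add: template_dist_def f_def)
qed

text \<open>
  Distance less than \<open>1/4 = 1/2\<^sup>2\<close> forces agreement in the first two entries. The second entry is
  then \<open>1\<close>, and the first later deviation from \<open>1\<close> is the required descent.
\<close>

lemma descent_of_near_template_01:
  assumes s: "s \<in> templates 2" and ne: "s \<noteq> template_01"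
    and close: "template_dist 2 s template_01 < 1 / 4"
  obtains m where "s (Suc m) = 1" and "s (Suc (Suc m)) = 0"
proof -
  have agree: "s n = template_01 n" if "n = 1 \<or> n = 2" for n
    using template_dist_ge[OF _ s template_01_in_templates, of n] that close
    by (force simp: power2_eq_square)
  have s2: "s 2 = 1"
    using agree[of 2] by (simp add: template_01_def)
  obtain k where k: "k \<ge> 1" "s k \<noteq> template_01 k"
    using ne s template_01_in_templates PiE_ext[of s "{1..}" _ template_01]
    unfolding templates_def by (metis atLeast_iff)
  have k3: "k \<ge> 3"
    using agree[of k] k by (cases "k = 1 \<or> k = 2") auto
  have sk: "s k = 0"
    using k k3 templates_ltD[OF s k(1)] by (simp add: template_01_def)
  have "\<exists>m. s (Suc m) = 1 \<and> s (Suc (Suc m)) = 0"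
  proof (rule ccontr)
    assume no: "\<not> ?thesis"
    have "s n = 1" if "n \<ge> 2" for n
      using that
    proof (induction n rule: dec_induct)
      case (step n)
      then obtain m where "n = Suc m"
        by (cases n) auto
      then show ?case
        using step no templates_ltD[OF s, of "Suc n"] by force
    qed (rule s2)
    then show False
      using sk k3 by force
  qed
  then show ?thesis
    using that by blast
qed

text \<open>
  The parameter \<open>c\<^sub>0 = 2\<close>, \<open>c\<^sub>1 = -2\<close>, \<open>d\<^sub>0 = d\<^sub>1 = 2\<close>, extensional outside \<open>{0, 1}\<close>.
\<close>

definition two_minus_two :: param where
  "two_minus_two = ((\<lambda>i\<in>{0..<2}. if i = 0 then 2 else - 2), (\<lambda>i\<in>{0..<2}. 2))"

lemma two_minus_two_in_mandelbrot: "two_minus_two \<in> mandelbrot_fixed 2 2 template_01"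
proof -
  let ?it = "template_iter template_01 two_minus_two"
  have orbit: "(n = m \<and> ?it m n 0 = 0) \<or> (n > m \<and> ?it m n 0 \<in> {2, -2})" if "m \<le> n" for m n
    using that
  proof (induction n rule: dec_induct)
    case (step n)
    then show ?case
      by (auto simp: template_iter_Suc template_poly_def two_minus_two_def template_01_def)
  qed simp
  have "cmod (?it m n 0) \<le> 2" if "m \<le> n" for m n
    using orbit[OF that] by auto
  then have "bounded ((\<lambda>n. ?it m n 0) ` {m..})" for m
    by (auto intro!: boundedI[of _ 2])
  moreover have "two_minus_two \<in> param_space 2 2"
    by (auto simp: two_minus_two_def param_space_def)
  ultimately show ?thesis
    by (simp add: mandelbrot_fixed_def)
qed

text \<open>
  If \<open>|w| \<ge> 3\<close> and \<open>|c| \<le> 5/2\<close>, then \<open>|w\<^sup>2 + c| \<ge> 3|w| - 5/2 \<ge> |w| + 1\<close>: outside the disc of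
  radius 3, each step increases the modulus by at least 1, whichever polynomial is applied.
\<close>

lemma template_iter_escape:
  assumes s: "s \<in> templates D"
    and c: "\<And>i. i < D \<Longrightarrow> cmod (fst p i) \<le> 5 / 2"
    and d: "\<And>i. i < D \<Longrightarrow> snd p i = 2"
    and mk: "m \<le> k" and start: "cmod (template_iter s p m k z) \<ge> 3"
  shows "cmod (template_iter s p m (k + j) z) \<ge> 3 + real j"
proof (induction j)
  case (Suc j)
  let ?w = "template_iter s p m (k + j) z" and ?i = "s (Suc (k + j))"
  have i: "?i < D"
    by (rule templates_ltD[OF s]) simp
  have "cmod ?w * 3 \<le> cmod ?w * cmod ?w"
    using Suc by (intro mult_left_mono) auto
  then have "4 + real j \<le> cmod (?w ^ 2) - cmod (fst p ?i)"
    using Suc c[OF i] by (simp add: norm_mult power2_eq_square)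
  also have "\<dots> \<le> cmod (?w ^ 2 + fst p ?i)"
    using norm_diff_ineq by blast
  also have "\<dots> = cmod (template_iter s p m (k + Suc j) z)"
    using mk d[OF i] by (simp add: template_iter_Suc template_poly_def)
  finally show ?case
    by simp
qed (use start in simp)

lemma mandelbrot_far_from_two_minus_two:
  assumes s: "s \<in> templates 2" and s1: "s (Suc m) = 1" and s0: "s (Suc (Suc m)) = 0"
    and p: "p \<in> mandelbrot_fixed 2 2 s"
  shows "param_dist 2 two_minus_two p \<ge> 1 / 2"
proof (rule ccontr)
  assume "\<not> ?thesis"
  then have close: "param_dist 2 two_minus_two p < 1 / 2"
    by simp
  define e0 where "e0 = fst p 0 - 2"
  define e1 where "e1 = fst p 1 + 2"
  have "cmod (fst p i - fst two_minus_two i) \<le> param_dist 2 two_minus_two p" if "i < 2" for i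
    unfolding param_dist_def using that by (subst Max_ge_iff) (auto intro!: bexI[of _ i])
  then have "cmod (fst p i - fst two_minus_two i) < 1 / 2" if "i < 2" for i
    using close that by (meson le_less_trans)
  from this[of 0] this[of 1] have e: "cmod e0 < 1 / 2" "cmod e1 < 1 / 2"
    by (auto simp: e0_def e1_def two_minus_two_def)
  have d: "snd p i = 2" if "i < 2" for i
    using p that by (fastforce simp: mandelbrot_fixed_def param_space_def PiE_iff)
  have "fst p 0 = 2 + e0" "fst p 1 = e1 - 2"
    by (simp_all add: e0_def e1_def)
  then have "cmod (fst p 0) \<le> 5 / 2" "cmod (fst p 1) \<le> 5 / 2"
    using e norm_triangle_ineq[of 2 e0] norm_triangle_ineq4[of e1 2] by auto
  then have c: "cmod (fst p i) \<le> 5 / 2" if "i < 2" for i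
    using that by (auto simp: less_2_cases_iff)
  \<comment> \<open>\<open>c\<^sub>1\<^sup>2 + c\<^sub>0 = (e1 - 2)\<^sup>2 + 2 + e0\<close>, a perturbation of \<open>6\<close> by at most \<open>2 + 1/4 + 1/2\<close>\<close>
  have it2: "template_iter s p m (Suc (Suc m)) 0 = 6 - (4 * e1 - e1\<^sup>2 - e0)"
    using d by (simp add: template_iter_Suc template_poly_def s0 s1 e0_def e1_def
        power2_eq_square algebra_simps)
  have "cmod (e1\<^sup>2) \<le> 1 / 4"
    using e(2) power_mono[of "cmod e1" "1 / 2" 2] by (simp add: norm_mult power2_eq_square)
  then have "cmod (4 * e1 - e1\<^sup>2 - e0) \<le> 3"
    using e norm_triangle_ineq4[of "4 * e1 - e1\<^sup>2" e0] norm_triangle_ineq4[of "4 * e1" "e1\<^sup>2"]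
    by (simp add: norm_mult)
  then have "cmod (template_iter s p m (Suc (Suc m)) 0) \<ge> 3"
    using norm_triangle_ineq2[of 6 "4 * e1 - e1\<^sup>2 - e0"] by (simp add: it2)
  then have esc: "cmod (template_iter s p m (Suc (Suc m) + j) 0) \<ge> 3 + real j" for j
    using s c d by (intro template_iter_escape) auto
  have "bounded ((\<lambda>n. template_iter s p m n 0) ` {m..})"
    using p by (simp add: mandelbrot_fixed_def)
  then obtain B where B: "\<And>n. n \<ge> m \<Longrightarrow> cmod (template_iter s p m n 0) \<le> B"
    by (auto simp: bounded_iff)
  obtain j where "real j > B"
    using reals_Archimedean2 by blast
  then show False
    using esc[of j] B[of "Suc (Suc m) + j"] by simp
qed

theorem theorem3p2:
  fixes sN :: "nat \<Rightarrow> template"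
  assumes "\<And>N. N \<ge> 1 \<Longrightarrow> sN N \<in> templates 2"
    and "(\<lambda>N. template_dist 2 (sN N) template_01) \<longlonglongrightarrow> 0"
    and "infinite {N. N \<ge> 1 \<and> sN N \<noteq> template_01}"
  shows "\<not> ((\<lambda>N. one_sided_dist (param_dist 2)
                   (mandelbrot_fixed 2 2 template_01)
                   (mandelbrot_fixed 2 2 (sN N))) \<longlonglongrightarrow> 0)"
proof
  let ?dist = "\<lambda>N. one_sided_dist (param_dist 2)
                   (mandelbrot_fixed 2 2 template_01) (mandelbrot_fixed 2 2 (sN N))"
  assume "?dist \<longlonglongrightarrow> 0"
  then have "\<forall>\<^sub>F N in sequentially. ?dist N < ennreal (1 / 2)"
    by (rule order_tendstoD) (rule ennreal_less_zero_iff[THEN iffD2], simp)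
  moreover have "\<forall>\<^sub>F N in sequentially. template_dist 2 (sN N) template_01 < 1 / 4"
    using assms(2) by (rule order_tendstoD) simp
  ultimately have "\<forall>\<^sub>F N in sequentially.
      ?dist N < ennreal (1 / 2) \<and> template_dist 2 (sN N) template_01 < 1 / 4"
    by (rule eventually_conj)
  then obtain N\<^sub>0 where N0: "\<And>N. N \<ge> N\<^sub>0 \<Longrightarrow>
      ?dist N < ennreal (1 / 2) \<and> template_dist 2 (sN N) template_01 < 1 / 4"
    by (auto simp: eventually_sequentially)
  obtain N where N: "N \<ge> N\<^sub>0" "N \<ge> 1" "sN N \<noteq> template_01"
    using assms(3) unfolding infinite_nat_iff_unbounded_le by blast
  obtain m where m: "sN N (Suc m) = 1" "sN N (Suc (Suc m)) = 0"
    using descent_of_near_template_01 assms(1) N N0 by blast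
  have "ennreal (1 / 2) \<le> (INF q\<in>mandelbrot_fixed 2 2 (sN N).
      ennreal (param_dist 2 two_minus_two q))"
    using mandelbrot_far_from_two_minus_two[OF assms(1)[OF N(2)] m]
    by (intro INF_greatest ennreal_leI)
  also have "\<dots> \<le> ?dist N"
    unfolding one_sided_dist_def by (rule SUP_upper[OF two_minus_two_in_mandelbrot])
  finally show False
    using N0[OF N(1)] by (meson not_less)
qed

end
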